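(* Let $0\le s<t<v\le t_N$ and let $g\in\mathscr L^\infty(\mathcal F_s)$ and $f\in\mathscr L^\infty(\mathcal F_v)$ be such that $g\succeq_{s,v}f$ (resp. $g\preceq_{s,v}f$). Then $g\succeq_{s,t}h$ (resp. $g\preceq_{s,t}h$) for any $h\in\mathscr L^\infty(\mathcal F_t)$ such that $h\sim_{t,v}f$.
   Context: $(\Omega,\mathcal F)$ is a measurable space with a filtration $\{\mathcal F_t\}_{t\ge0}$, $\mathcal F_0=\{\emptyset,\Omega\}$, and $t_0=0<t_1<\dots<t_N$ are fixed times. $\mathscr L^\infty(\mathcal G)$ denotes the set of bounded $\mathcal G$-measurable real functions on $\Omega$. $\mathbb P$ is a probability on $\mathcal F_{t_N}$ and $$u(t,x,\omega)=\sum_{i=0}^{N-1}u_i(x,\omega)\mathbf 1_{[t_i,t_{i+1})}(t)+u_N(x,\omega)\mathbf 1_{t_N}(t)$$ is a Stochastic Dynamic Utility, where $u_0:\mathbb R\to\mathbb R$ is a fixed strictly increasing continuous function with $u_0(0)=0$, satisfying for $i=0,\dots,N$: (a) $u(t_i,x,\cdot)$ is $\mathcal F_{t_i}$-measurable and $E_{\mathbb P}[|u(t_i,x,\cdot)|]<\infty$ for all $x\in\mathbb R$; (b) $u(t_i,\cdot,\omega)$ is strictly increasing and $u(t_i,0,\omega)=0$ for all $\omega$; (c) $u(t_i,\cdot,\cdot)$ is $\star$-continuous on $(\Omega,\mathcal F_{t_i},\mathbb P)$, i.e. for every $f\in\mathscr L^\infty(\mathcal F_{t_i})$ the map $\omega\mapsto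 u(t_i,f(\omega),\omega)$ is $\mathcal F_{t_i}$-measurable and for $\mathbb P$-a.e. $\omega$ the function $u(t_i,\cdot,\omega)$ is continuous at $f(\omega)$; (d) for $i\le N-1$ and every $f\in\mathscr L^\infty(\mathcal F_{t_{i+1}})$, $E_{\mathbb P}[u(t_{i+1},f)\mid\mathcal F_{t_i}]$ is $\mathbb P$-a.s. equal to $u(t_i,g)$ for some $g\in\mathscr L^\infty(\mathcal F_{t_i})$. Here $u(t,f)$ denotes $\omega\mapsto u(t,f(\omega),\omega)$. The intertemporal preferences are extended to arbitrary times $s<t$ as follows: for $g\in\mathscr L^\infty(\mathcal F_s)$ and $f\in\mathscr L^\infty(\mathcal F_t)$, $$g\succeq_{s,t}f\iff u(s,g)\ge E_{\mathbb P}[u(t,f)\mid\mathcal F_s]\ \ \mathbb P\text{-a.s.},\qquad g\preceq_{s,t}f\iff u(s,g)\le E_{\mathbb P}[u(t,f)\mid\mathcal F_s]\ \ \mathbb P\text{-a.s.},$$ and $g\sim_{s,t}f$ iff both $g\succeq_{s,t}f$ and $g\preceq_{s,t}f$. It is implicit in this definition that the random variables $u(t,f)$ involved are measurable and $\mathbb P$-integrable, so that the conditional expectations make sense. *)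

theory Defs
  imports "HOL-Probability.Probability"
begin

text \<open>
  Sub-sigma-algebras are represented by measures of which only \<open>space\<close> and \<open>sets\<close>
  are used. Random variables are total functions on \<open>'a\<close>; their values outside the
  space are irrelevant.
\<close>

definition Linf :: "'a measure \<Rightarrow> ('a \<Rightarrow> real) set" where
  "Linf G = {f \<in> borel_measurable G. bounded (f ` space G)}"

definition ueval :: "(real \<Rightarrow> real \<Rightarrow> 'a \<Rightarrow> real) \<Rightarrow> real \<Rightarrow> ('a \<Rightarrow> real) \<Rightarrow> 'a \<Rightarrow> real" where
  "ueval u t f = (\<lambda>\<omega>. u t (f \<omega>) \<omega>)"

definition star_continuous :: "'a measure \<Rightarrow> (real \<Rightarrow> 'a \<Rightarrow> real) \<Rightarrow> bool" where
  "star_continuous M \<phi> \<longleftrightarrow>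
     (\<forall>f \<in> Linf M. (\<lambda>\<omega>. \<phi> (f \<omega>) \<omega>) \<in> borel_measurable M \<and>
                   (AE \<omega> in M. isCont (\<lambda>x. \<phi> x \<omega>) (f \<omega>)))"

definition sdu :: "nat \<Rightarrow> (nat \<Rightarrow> real) \<Rightarrow> (nat \<Rightarrow> real \<Rightarrow> 'a \<Rightarrow> real)
    \<Rightarrow> real \<Rightarrow> real \<Rightarrow> 'a \<Rightarrow> real" where
  "sdu N ts U t x \<omega> =
     (\<Sum>i<N. U i x \<omega> * indicat_real {ts i..<ts (Suc i)} t) + U N x \<omega> * indicat_real {ts N} t"

text \<open>
  \<open>M\<close> is the measurable space \<open>(\<Omega>, \<F>)\<close> (its measure plays no role), \<open>F\<close> the
  filtration, constrained at nonnegative times only, and \<open>P\<close> the probability, defined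
  exactly on \<open>F (ts N)\<close>. The triple \<open>(\<Omega>, F (ts i), P)\<close> is \<open>restr_to_subalg P (F (ts i))\<close>.
\<close>

locale stochastic_dynamic_utility = prob_space P
  for P :: "'a measure" +
  fixes M :: "'a measure"
    and F :: "real \<Rightarrow> 'a measure"
    and N :: nat
    and ts :: "nat \<Rightarrow> real"
    and u0 :: "real \<Rightarrow> real"
    and U :: "nat \<Rightarrow> real \<Rightarrow> 'a \<Rightarrow> real"
    and u :: "real \<Rightarrow> real \<Rightarrow> 'a \<Rightarrow> real"
  assumes filtration_subalg: "\<And>t. 0 \<le> t \<Longrightarrow> subalgebra M (F t)"
    and filtration_mono: "\<And>s t. 0 \<le> s \<Longrightarrow> s \<le> t \<Longrightarrow> subalgebra (F t) (F s)"
    and filtration_zero: "sets (F 0) = {{}, space M}"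
    and ts_zero: "ts 0 = 0"
    and ts_less: "\<And>i. i < N \<Longrightarrow> ts i < ts (Suc i)"
    and sets_P: "sets P = sets (F (ts N))"
    and u_eq: "u = sdu N ts U"
    and u0_strict_mono: "strict_mono u0"
    and u0_continuous: "continuous_on UNIV u0"
    and u0_zero: "u0 0 = 0"
    and U_zero: "\<And>x \<omega>. \<omega> \<in> space M \<Longrightarrow> U 0 x \<omega> = u0 x"
    and u_measurable: "\<And>i x. i \<le> N \<Longrightarrow> u (ts i) x \<in> borel_measurable (F (ts i))"
    and u_integrable: "\<And>i x. i \<le> N \<Longrightarrow> integrable P (u (ts i) x)"
    and u_strict_mono: "\<And>i \<omega>. i \<le> N \<Longrightarrow> \<omega> \<in> space M \<Longrightarrow> strict_mono (\<lambda>x. u (ts i) x \<omega>)"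
    and u_zero: "\<And>i \<omega>. i \<le> N \<Longrightarrow> \<omega> \<in> space M \<Longrightarrow> u (ts i) 0 \<omega> = 0"
    and u_star_continuous:
      "\<And>i. i \<le> N \<Longrightarrow> star_continuous (restr_to_subalg P (F (ts i))) (u (ts i))"
    and u_certainty_equivalent:
      "\<And>i f. i < N \<Longrightarrow> f \<in> Linf (F (ts (Suc i))) \<Longrightarrow>
         \<exists>g \<in> Linf (F (ts i)).
           AE \<omega> in P. real_cond_exp P (F (ts i)) (ueval u (ts (Suc i)) f) \<omega> = ueval u (ts i) g \<omega>"

text \<open>
  At times \<open>t\<close> strictly between grid points \<open>ueval u t f\<close> need not be measurable, because
  star-continuity only concerns \<open>F (ts i)\<close>-measurable arguments, while \<open>real_cond_exp\<close>
  is total. Measurability and integrability are therefore part of the preference relations.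
\<close>

definition well_defined_utility ::
    "'a measure \<Rightarrow> (real \<Rightarrow> 'a measure) \<Rightarrow> (real \<Rightarrow> real \<Rightarrow> 'a \<Rightarrow> real)
      \<Rightarrow> real \<Rightarrow> ('a \<Rightarrow> real) \<Rightarrow> bool" where
  "well_defined_utility P F u t f \<longleftrightarrow>
     ueval u t f \<in> borel_measurable (F t) \<and> integrable P (ueval u t f)"

definition pref_ge ::
    "'a measure \<Rightarrow> (real \<Rightarrow> 'a measure) \<Rightarrow> (real \<Rightarrow> real \<Rightarrow> 'a \<Rightarrow> real)
      \<Rightarrow> real \<Rightarrow> real \<Rightarrow> ('a \<Rightarrow> real) \<Rightarrow> ('a \<Rightarrow> real) \<Rightarrow> bool" where
  "pref_ge P F u s t g f \<longleftrightarrow>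
     well_defined_utility P F u s g \<and> well_defined_utility P F u t f \<and>
     (AE \<omega> in P. ueval u s g \<omega> \<ge> real_cond_exp P (F s) (ueval u t f) \<omega>)"

definition pref_le ::
    "'a measure \<Rightarrow> (real \<Rightarrow> 'a measure) \<Rightarrow> (real \<Rightarrow> real \<Rightarrow> 'a \<Rightarrow> real)
      \<Rightarrow> real \<Rightarrow> real \<Rightarrow> ('a \<Rightarrow> real) \<Rightarrow> ('a \<Rightarrow> real) \<Rightarrow> bool" where
  "pref_le P F u s t g f \<longleftrightarrow>
     well_defined_utility P F u s g \<and> well_defined_utility P F u t f \<and>
     (AE \<omega> in P. ueval u s g \<omega> \<le> real_cond_exp P (F s) (ueval u t f) \<omega>)"

definition pref_eq ::
    "'a measure \<Rightarrow> (real \<Rightarrow> 'a measure) \<Rightarrow> (real \<Rightarrow> real \<Rightarrow> 'a \<Rightarrow> real)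
      \<Rightarrow> real \<Rightarrow> real \<Rightarrow> ('a \<Rightarrow> real) \<Rightarrow> ('a \<Rightarrow> real) \<Rightarrow> bool" where
  "pref_eq P F u s t g f \<longleftrightarrow> pref_ge P F u s t g f \<and> pref_le P F u s t g f"

end

theory Submission
  imports Defs
begin

text \<open>Indifference of \<open>h\<close> and \<open>f\<close> between \<open>t\<close> and
  \<open>v\<close> means that u(t,h) is a version of E[u(v,f) | F_t]. Conditioning on the smaller
  F_s and using the tower property gives E[u(t,h) | F_s] = E[u(v,f) | F_s] almost surely, which is
  \<open>cond_exp_eq_of_pref_eq\<close>. Comparing u(s,g) with either side is then the same
  comparison, whichever way the inequality points.\<close>

lemma cond_exp_eq_of_pref_eq:
  assumes "sigma_finite_subalgebra P (F s)" "subalgebra P (F t)" "subalgebra (F t) (F s)"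
    and "pref_eq P F u t v h f"
  shows "AE \<omega> in P. real_cond_exp P (F s) (ueval u t h) \<omega> = real_cond_exp P (F s) (ueval u v f) \<omega>"
proof -
  interpret sigma_finite_subalgebra P "F s" by fact
  have int: "integrable P (ueval u t h)" "integrable P (ueval u v f)"
    and eq: "AE \<omega> in P. ueval u t h \<omega> = real_cond_exp P (F t) (ueval u v f) \<omega>"
    using assms(4)
    by (auto simp: pref_eq_def pref_ge_def pref_le_def well_defined_utility_def)
  \<comment> \<open>Almost surely equal variables have the same conditional expectation; the
    measurability this requires comes from \<open>int\<close>.\<close>
  have "AE \<omega> in P. real_cond_exp P (F s) (ueval u t h) \<omega>
      = real_cond_exp P (F s) (real_cond_exp P (F t) (ueval u v f)) \<omega>"
    by (rule real_cond_exp_cong[OF eq]) (use int in auto)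
  moreover have "AE \<omega> in P. real_cond_exp P (F s) (real_cond_exp P (F t) (ueval u v f)) \<omega>
      = real_cond_exp P (F s) (ueval u v f) \<omega>"
    by (rule real_cond_exp_nested_subalg[OF assms(2,3) int(2)])
  ultimately show ?thesis by eventually_elim simp
qed

text \<open>Since \<open>P\<close> lives exactly on \<open>F (ts N)\<close>, monotonicity of the
  filtration up to the horizon makes conditioning on \<open>F t\<close> meaningful.\<close>

lemma (in stochastic_dynamic_utility) subalgebra_P:
  assumes "0 \<le> t" "t \<le> ts N"
  shows "subalgebra P (F t)"
  using filtration_mono[OF assms] sets_P sets_eq_imp_space_eq[OF sets_P]
  by (auto simp: subalgebra_def)

theorem proposition3p8:
  fixes P M :: "'a measure" and F :: "real \<Rightarrow> 'a measure"
    and N :: nat and ts :: "nat \<Rightarrow> real" and u0 :: "real \<Rightarrow> real"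
    and U :: "nat \<Rightarrow> real \<Rightarrow> 'a \<Rightarrow> real" and u :: "real \<Rightarrow> real \<Rightarrow> 'a \<Rightarrow> real"
    and s t v :: real and f g :: "'a \<Rightarrow> real"
  assumes "stochastic_dynamic_utility P M F N ts u0 U u"
    and "0 \<le> s" and "s < t" and "t < v" and "v \<le> ts N"
    and "g \<in> Linf (F s)" and "f \<in> Linf (F v)"
  shows "(pref_ge P F u s v g f \<longrightarrow>
            (\<forall>h \<in> Linf (F t). pref_eq P F u t v h f \<longrightarrow> pref_ge P F u s t g h)) \<and>
         (pref_le P F u s v g f \<longrightarrow>
            (\<forall>h \<in> Linf (F t). pref_eq P F u t v h f \<longrightarrow> pref_le P F u s t g h))"
proof -
  interpret stochastic_dynamic_utility P M F N ts u0 U u by fact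
  have sub: "subalgebra P (F s)" "subalgebra P (F t)" "subalgebra (F t) (F s)"
    using assms(2-5) by (auto intro: subalgebra_P filtration_mono)
  \<comment> \<open>A probability restricted to a sub-sigma-algebra stays finite, hence
    sigma-finite, as conditioning on \<open>F s\<close> demands.\<close>
  interpret finite_measure_subalgebra P "F s"
    by standard (rule sub(1))
  have tower: "AE \<omega> in P. real_cond_exp P (F s) (ueval u t h) \<omega>
      = real_cond_exp P (F s) (ueval u v f) \<omega>" if "pref_eq P F u t v h f" for h
    using cond_exp_eq_of_pref_eq[OF _ sub(2,3) that] sigma_finite_subalgebra_axioms by blast
  show ?thesis
  proof (intro conjI impI ballI)
    fix h
    assume "pref_ge P F u s v g f" and h: "pref_eq P F u t v h f"
    moreover from this(1) have "AE \<omega> in P. ueval u s g \<omega> \<ge> real_cond_exp P (F s) (ueval u v f) \<omega>"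
      by (simp add: pref_ge_def)
    with tower[OF h] have "AE \<omega> in P. ueval u s g \<omega> \<ge> real_cond_exp P (F s) (ueval u t h) \<omega>"
      by eventually_elim simp
    \<comment> \<open>Besides the inequality, the relation asks for well-defined utilities: that of
      \<open>g\<close> comes from its comparison with \<open>f\<close>, that of \<open>h\<close>
      from the indifference.\<close>
    ultimately show "pref_ge P F u s t g h"
      by (simp add: pref_eq_def pref_ge_def)
  next
    fix h
    assume "pref_le P F u s v g f" and h: "pref_eq P F u t v h f"
    moreover from this(1) have "AE \<omega> in P. ueval u s g \<omega> \<le> real_cond_exp P (F s) (ueval u v f) \<omega>"
      by (simp add: pref_le_def)
    with tower[OF h] have "AE \<omega> in P. ueval u s g \<omega> \<le> real_cond_exp P (F s) (ueval u t h) \<omega>"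
      by eventually_elim simp
    ultimately show "pref_le P F u s t g h"
      by (simp add: pref_eq_def pref_le_def)
  qed
qed

end
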